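(* Fix $a\in[0,1]$. Let $(X,f)$ and $(Y,g)$ be set-function pairs, with $f:X\times X\to\mathbb{R}$ and $g:Y\times Y\to\mathbb{R}$ arbitrary functions. Then $$d_{CD}\big((X,\operatorname{sym}_a(f)),(Y,\operatorname{sym}_a(g))\big)\le 2\,d_{CD}\big((X,f),(Y,g)\big).$$
   Context: A set-function pair $(X,f)$ is a set $X$ with a function $f:X\times X\to\mathbb{R}$. A correspondence between $X$ and $Y$ is a subset $\mathcal{M}\subset X\times Y$ such that every $x\in X$ has some $y\in Y$ with $(x,y)\in\mathcal{M}$ and every $y\in Y$ has some $x\in X$ with $(x,y)\in\mathcal{M}$. Its distortion is $dis_{(X,f),(Y,g)}(\mathcal{M})=\sup_{(x_1,y_1),(x_2,y_2)\in\mathcal{M}}|f(x_1,x_2)-g(y_1,y_2)|$. The correspondence distortion distance is $d_{CD}((X,f),(Y,g))=\frac12\inf_{\mathcal{M}}dis_{(X,f),(Y,g)}(\mathcal{M})\in[0,\infty]$, the infimum over all correspondences between $X$ and $Y$. For $f:X\times X\to\mathbb{R}$ and $a\in[0,1]$, $\operatorname{sym}_a(f):X\times X\to\mathbb{R}$ is the symmetric function $\operatorname{sym}_a(f)(x,y)=a\min\{f(x,y),f(y,x)\}+(1-a)\max\{f(x,y),f(y,x)\}$. *)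

theory Defs
  imports Complex_Main "HOL-Library.Extended_Nonnegative_Real"
begin

text \<open>
  In a set-function pair \<open>(X, f)\<close> only the values of \<open>f\<close> on \<open>X \<times> X\<close> are meaningful.
  The distance below does not depend on the others, because every correspondence is contained
  in \<open>X \<times> Y\<close>.
\<close>

type_synonym 'a set_fun_pair = "'a set \<times> ('a \<Rightarrow> 'a \<Rightarrow> real)"

definition correspondences :: "'a set \<Rightarrow> 'b set \<Rightarrow> ('a \<times> 'b) set set" where
  "correspondences X Y =
     {M. M \<subseteq> X \<times> Y \<and> (\<forall>x\<in>X. \<exists>y\<in>Y. (x, y) \<in> M) \<and> (\<forall>y\<in>Y. \<exists>x\<in>X. (x, y) \<in> M)}"

text \<open>
  Suprema and infima are taken in \<open>[0, \<infinity>]\<close>: the distortion of the empty correspondence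
  is \<open>0\<close>, and the distance is \<open>\<infinity>\<close> if there is no correspondence (exactly one
  of the two sets is empty).
\<close>

definition distortion ::
    "('a \<Rightarrow> 'a \<Rightarrow> real) \<Rightarrow> ('b \<Rightarrow> 'b \<Rightarrow> real) \<Rightarrow> ('a \<times> 'b) set \<Rightarrow> ennreal" where
  "distortion f g M = (SUP ((x1, y1), (x2, y2)) \<in> M \<times> M. ennreal \<bar>f x1 x2 - g y1 y2\<bar>)"

definition d_CD :: "'a set_fun_pair \<Rightarrow> 'b set_fun_pair \<Rightarrow> ennreal" where
  "d_CD P Q =
     (case (P, Q) of ((X, f), (Y, g)) \<Rightarrow> (1 / 2) * (INF M \<in> correspondences X Y. distortion f g M))"

definition symmetrize :: "real \<Rightarrow> ('a \<Rightarrow> 'a \<Rightarrow> real) \<Rightarrow> 'a \<Rightarrow> 'a \<Rightarrow> real" where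
  "symmetrize a f x y = a * min (f x y) (f y x) + (1 - a) * max (f x y) (f y x)"

end

theory Submission imports Defs begin

text \<open>
  Both \<open>min\<close> and \<open>max\<close> are 1-Lipschitz for the supremum norm on the plane, hence so is their
  convex combination. Thus symmetrizing does not increase the distortion of any correspondence,
  and the inequality holds even without the factor 2.
\<close>

lemma abs_symmetrize_diff_le:
  assumes "a \<in> {0..1}"
  shows "\<bar>symmetrize a f x1 x2 - symmetrize a g y1 y2\<bar>
    \<le> max \<bar>f x1 x2 - g y1 y2\<bar> \<bar>f x2 x1 - g y2 y1\<bar>" (is "_ \<le> ?d")
proof -
  let ?m = "min (f x1 x2) (f x2 x1) - min (g y1 y2) (g y2 y1)"
  let ?M = "max (f x1 x2) (f x2 x1) - max (g y1 y2) (g y2 y1)"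
  have "symmetrize a f x1 x2 - symmetrize a g y1 y2 = a * ?m + (1 - a) * ?M"
    by (simp add: symmetrize_def algebra_simps)
  also have "\<bar>\<dots>\<bar> \<le> a * \<bar>?m\<bar> + (1 - a) * \<bar>?M\<bar>"
    using assms abs_triangle_ineq[of "a * ?m" "(1 - a) * ?M"] by (simp add: abs_mult)
  \<comment> \<open>The 1-Lipschitz bounds \<open>\<bar>?m\<bar> \<le> ?d\<close> and
    \<open>\<bar>?M\<bar> \<le> ?d\<close> enter here; the weights \<open>a\<close> and
    \<open>1 - a\<close> are nonnegative.\<close>
  also have "\<dots> \<le> a * ?d + (1 - a) * ?d"
    using assms by (intro add_mono mult_left_mono) auto
  also have "\<dots> = ?d"
    by (simp add: algebra_simps)
  finally show ?thesis .
qed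

lemma abs_diff_le_distortion:
  assumes "(x1, y1) \<in> M" "(x2, y2) \<in> M"
  shows "ennreal \<bar>f x1 x2 - g y1 y2\<bar> \<le> distortion f g M"
  unfolding distortion_def
  using assms by (intro SUP_upper2[where i = "((x1, y1), (x2, y2))"]) auto

lemma distortion_symmetrize_le:
  assumes "a \<in> {0..1}"
  shows "distortion (symmetrize a f) (symmetrize a g) M \<le> distortion f g M"
proof -
  have "ennreal \<bar>symmetrize a f x1 x2 - symmetrize a g y1 y2\<bar> \<le> distortion f g M"
    if M: "(x1, y1) \<in> M" "(x2, y2) \<in> M" for x1 y1 x2 y2
  proof -
    have "ennreal \<bar>symmetrize a f x1 x2 - symmetrize a g y1 y2\<bar>
        \<le> ennreal (max \<bar>f x1 x2 - g y1 y2\<bar> \<bar>f x2 x1 - g y2 y1\<bar>)"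
      by (intro ennreal_leI abs_symmetrize_diff_le assms)
    also have "\<dots> \<le> distortion f g M"
      \<comment> \<open>\<open>M \<times> M\<close> is closed under swapping its two components, so
        the transposed difference is also among the values of the supremum.\<close>
      using abs_diff_le_distortion[OF M] abs_diff_le_distortion[OF M(2) M(1)]
      by (simp add: max_def)
    finally show ?thesis .
  qed
  then show ?thesis
    \<comment> \<open>Only the left distortion is unfolded; the right one stays intact as the upper
      bound.\<close>
    unfolding distortion_def[of "symmetrize a f"] by (intro SUP_least) auto
qed

text \<open>Both infima range over the same correspondences, since these depend only on
  \<open>X\<close> and \<open>Y\<close>; hence distortions can be compared one \<open>M\<close> at a
  time.\<close>

lemma d_CD_symmetrize_le:
  assumes "a \<in> {0..1}"
  shows "d_CD (X, symmetrize a f) (Y, symmetrize a g) \<le> d_CD (X, f) (Y, g)"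
  unfolding d_CD_def prod.case
  by (intro mult_left_mono INF_mono' distortion_symmetrize_le assms) simp

theorem theorem12:
  fixes a :: real
    and X :: "'a set" and f :: "'a \<Rightarrow> 'a \<Rightarrow> real"
    and Y :: "'b set" and g :: "'b \<Rightarrow> 'b \<Rightarrow> real"
  assumes "a \<in> {0..1}"
  shows "d_CD (X, symmetrize a f) (Y, symmetrize a g) \<le> 2 * d_CD (X, f) (Y, g)"
proof -
  \<comment> \<open>The explicit factor 1 reduces the next step to \<open>1 \<le> 2\<close>, also
    when the distance is infinite.\<close>
  have "d_CD (X, symmetrize a f) (Y, symmetrize a g) \<le> 1 * d_CD (X, f) (Y, g)"
    using d_CD_symmetrize_le[OF assms] by simp
  also have "\<dots> \<le> 2 * d_CD (X, f) (Y, g)"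
    by (intro mult_right_mono) simp_all
  finally show ?thesis .
qed

end
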